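(* For $k^2<\delta n$, $\log \mathrm{PS}_\delta(H^n_k)=\Omega(k\log(k/\delta))$; that is, any $\delta$-error randomized parity decision tree deciding the $k$-Hamming weight predicate on $\{0,1\}^n$ has size $\exp\Omega(k\log(k/\delta))$.
   Context: $H^n_k\colon\mathbb{F}_2^n\to\{0,1\}$ equals 1 iff its input has Hamming weight exactly $k$. A (deterministic) parity decision tree is a binary tree each of whose internal nodes is labeled by some $y\in\mathbb{F}_2^n$ and each leaf by an output in $\{0,1\}$; on input $x$ one walks from the root, at a node labeled $y$ going to the left child if $\langle x,y\rangle=0$ (inner product over $\mathbb{F}_2$) and to the right child otherwise, and outputs the label of the leaf reached. Its size is its total number of nodes. A $\delta$-error randomized parity decision tree for $P$ is a probability distribution over deterministic parity decision trees such that for every $x$ the sampled tree outputs $P(x)$ with probability at least $1-\delta$; its size is the maximum size of a tree in its support. $\mathrm{PS}_\delta(P)$ is the minimum size of a $\delta$-error randomized parity decision tree for $P$. Logarithms and $\exp$ are base 2.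
   Formalization: The error is restricted to δ ≤ 1/3 (and k ≥ 1): without a bound below 1/2 the claim fails, since for δ ≥ 1/2 a random constant answer has size 1; other fixed δ < 1/2 follow by majority votes and fixing some input bits. *)

theory Defs
  imports "HOL-Probability.Probability"
begin

text \<open>Vectors in F_2^n are boolean lists of length n.\<close>

definition hw_pred :: "nat \<Rightarrow> nat \<Rightarrow> bool list \<Rightarrow> bool" where
  "hw_pred n k x \<longleftrightarrow> count_list x True = k"

definition ip2 :: "bool list \<Rightarrow> bool list \<Rightarrow> bool" where
  "ip2 x y \<longleftrightarrow> odd (card {i. i < length x \<and> i < length y \<and> x ! i \<and> y ! i})"

datatype pdt = Leaf bool | Node "bool list" pdt pdt

fun pdt_eval :: "pdt \<Rightarrow> bool list \<Rightarrow> bool" where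
  "pdt_eval (Leaf b) x = b"
| "pdt_eval (Node y l r) x = (if ip2 x y then pdt_eval r x else pdt_eval l x)"

fun pdt_size :: "pdt \<Rightarrow> nat" where
  "pdt_size (Leaf b) = 1"
| "pdt_size (Node y l r) = 1 + pdt_size l + pdt_size r"

fun pdt_wf :: "nat \<Rightarrow> pdt \<Rightarrow> bool" where
  "pdt_wf n (Leaf b) = True"
| "pdt_wf n (Node y l r) = (length y = n \<and> pdt_wf n l \<and> pdt_wf n r)"

definition rpdt :: "nat \<Rightarrow> real \<Rightarrow> (bool list \<Rightarrow> bool) \<Rightarrow> pdt pmf \<Rightarrow> nat \<Rightarrow> bool" where
  "rpdt n \<delta> P D s \<longleftrightarrow>
     (\<forall>T\<in>set_pmf D. pdt_wf n T \<and> pdt_size T \<le> s) \<and>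
     (\<forall>x. length x = n \<longrightarrow> measure_pmf.prob D {T. pdt_eval T x = P x} \<ge> 1 - \<delta>)"

definition PS :: "nat \<Rightarrow> real \<Rightarrow> (bool list \<Rightarrow> bool) \<Rightarrow> nat" where
  "PS n \<delta> P = (LEAST s. \<exists>D. rpdt n \<delta> P D s)"

end

theory Submission
  imports Defs
begin

text \<open>
  A leaf of a parity decision tree is a fibre of a syndrome map, and the random walk on the cube that
  flips uniformly chosen coordinates projects to a walk on syndromes with a symmetric kernel. Let
  m(t) be the probability that the t-step walk lands in a given leaf labelled 1. As the walk rarely
  flips a coordinate twice, on most of the mass m(k+2) is at most \<theta> m(k) with \<theta> = O(\<delta>), and
  m(k-2) is small as well. Such a leaf satisfies m(k) \<le> (e \<theta> / sqrt k)^(k/2), so there are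
  many leaves.

  For the last claim write F and B for the heat emitted by the start and by the target. Splicing a
  backward step into a k-step walk at its edge (x, y) number i gives a (k+2)-step walk, and the weight
  changes by the factor r = F(i+1,y) B(k-i,x) / (F(i,x) B(k-i-1,y)). Along every walk the product of
  these factors telescopes to m(k)^2, so the average of ln r over the edges is (2/k) ln m(k). The
  gain of a power of k comes from the fact that splices at different edges are essentially distinct:
  the splice position is the first time at which the prefix could be shortened by two steps, unless
  the prefix of the original walk could be shortened, and such walks are rare because m(k-2) is small.

  Large \<delta> is reduced to small \<delta> by iterated majority votes, the walk then starting at a vector of
  weight k - t with t a small constant fraction of k.
\<close>

section \<open>Heat flow under a symmetric kernel\<close>

locale symmetric_kernel =
  fixes \<Omega> :: "'a set" and S :: "'a \<Rightarrow> 'a \<Rightarrow> real"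
  assumes finite_states [simp]: "finite \<Omega>"
    and kernel_nonneg [simp]: "0 \<le> S x y"
    and kernel_sym: "S x y = S y x"
begin

definition diffuse :: "('a \<Rightarrow> real) \<Rightarrow> 'a \<Rightarrow> real" where
  "diffuse f x = (\<Sum>y\<in>\<Omega>. S x y * f y)"

definition heat :: "'a \<Rightarrow> nat \<Rightarrow> 'a \<Rightarrow> real" where
  "heat a t = (diffuse ^^ t) (\<lambda>x. of_bool (x = a))"

definition pairing :: "('a \<Rightarrow> real) \<Rightarrow> ('a \<Rightarrow> real) \<Rightarrow> real" where
  "pairing f g = (\<Sum>x\<in>\<Omega>. f x * g x)"

lemma heat_0: "heat a 0 x = of_bool (x = a)"
  by (simp add: heat_def)

lemma heat_Suc: "heat a (Suc t) = diffuse (heat a t)"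
  by (simp add: heat_def)

lemma diffuse_nonneg: "(\<And>x. 0 \<le> f x) \<Longrightarrow> 0 \<le> diffuse f x"
  by (simp add: diffuse_def sum_nonneg)

lemma diffuse_mono: "(\<And>x. f x \<le> g x) \<Longrightarrow> diffuse f x \<le> diffuse g x"
  by (auto simp: diffuse_def intro!: sum_mono mult_left_mono)

lemma heat_nonneg [simp]: "0 \<le> heat a t x"
  by (induction t arbitrary: x) (auto simp: heat_0 heat_Suc intro: diffuse_nonneg)

lemma pairing_nonneg: "(\<And>x. 0 \<le> f x) \<Longrightarrow> (\<And>x. 0 \<le> g x) \<Longrightarrow> 0 \<le> pairing f g"
  by (simp add: pairing_def sum_nonneg)

lemma pairing_mono:
  "(\<And>x. 0 \<le> f x) \<Longrightarrow> (\<And>x. f x \<le> f' x) \<Longrightarrow> (\<And>x. 0 \<le> g x) \<Longrightarrow> (\<And>x. g x \<le> g' x)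
    \<Longrightarrow> pairing f g \<le> pairing f' g'"
  unfolding pairing_def by (intro sum_mono mult_mono) (auto intro: order_trans)

lemma pairing_diffuse: "pairing (diffuse f) g = pairing f (diffuse g)"
proof -
  have "pairing (diffuse f) g = (\<Sum>x\<in>\<Omega>. \<Sum>y\<in>\<Omega>. S x y * f y * g x)"
    by (simp add: pairing_def diffuse_def sum_distrib_right)
  also have "\<dots> = (\<Sum>y\<in>\<Omega>. \<Sum>x\<in>\<Omega>. S x y * f y * g x)"
    by (rule sum.swap)
  also have "\<dots> = pairing f (diffuse g)"
    by (simp add: pairing_def diffuse_def sum_distrib_left kernel_sym mult_ac)
  finally show ?thesis .
qed

text \<open>Symmetry moves steps of the kernel across the pairing one at a time, so a walk may be
  cut at any time without changing the total weight. The delta at \<open>a\<close> is seen by the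
  sum only because \<open>a\<close> is a state.\<close>

lemma pairing_heat:
  assumes "a \<in> \<Omega>"
  shows "pairing (heat a i) (heat b j) = heat b (i + j) a"
proof (induction i arbitrary: j)
  case 0
  show ?case using assms by (simp add: pairing_def heat_0 if_distrib cong: if_cong)
next
  case (Suc i)
  then show ?case by (metis add_Suc_shift heat_Suc pairing_diffuse)
qed

lemma pairing_split:
  "pairing f g = pairing f (\<lambda>x. if P x then 0 else g x) + pairing f (\<lambda>x. if P x then g x else 0)"
  unfolding pairing_def sum.distrib [symmetric] by (rule sum.cong) auto

lemma pairing_if: "pairing (\<lambda>x. if P x then 0 else f x) g = pairing f (\<lambda>x. if P x then 0 else g x)"
  unfolding pairing_def by (rule sum.cong) auto

end

text \<open>The constants fit the factor 4 in \<open>shortcut\<close>: by \<open>longer\<close>,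
  edges whose splice ends at a non-shortcut carry at most m/4, and by \<open>shorter\<close>, with
  16 = 4 * 4, the walks that meet a shortcut weigh at most m/4.\<close>

locale heat_bridge = symmetric_kernel \<Omega> S for \<Omega> :: "'a set" and S +
  fixes a b :: 'a and k :: nat and \<theta> m :: real
  assumes a_state: "a \<in> \<Omega>" and b_state: "b \<in> \<Omega>"
    and k_pos: "1 \<le> k" and \<theta>_pos: "0 < \<theta>"
    and m_def: "m = heat b k a" and m_pos: "0 < m"
    and longer: "heat b (k + 2) a \<le> \<theta> * m"
    and shorter: "2 \<le> k \<Longrightarrow> 16 * \<theta> * heat b (k - 2) a \<le> m"
begin

abbreviation "F \<equiv> heat a"
abbreviation "B \<equiv> heat b"

section \<open>Shortcuts and the walks that avoid them\<close>

definition F2 :: "nat \<Rightarrow> 'a \<Rightarrow> real" where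
  "F2 i x = (if i < 2 then 0 else F (i - 2) x)"

definition shortcut :: "nat \<Rightarrow> 'a \<Rightarrow> bool" where
  "shortcut i x \<longleftrightarrow> F i x \<le> 4 * \<theta> * F2 i x"

text \<open>
  \<open>H i x\<close> is the weight of the i-step walks from \<open>a\<close> to \<open>x\<close> that meet no shortcut, and \<open>K r x\<close> that of
  the walks occupying the times k - r, ..., k, from \<open>x\<close> to \<open>b\<close>, that meet no shortcut after time k - r.
\<close>

primrec H :: "nat \<Rightarrow> 'a \<Rightarrow> real" where
  "H 0 = F 0"
| "H (Suc i) = (\<lambda>x. if shortcut (Suc i) x then 0 else diffuse (H i) x)"

primrec K :: "nat \<Rightarrow> 'a \<Rightarrow> real" where
  "K 0 = B 0"
| "K (Suc r) = diffuse (\<lambda>x. if shortcut (k - r) x then 0 else K r x)"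

lemma F2_nonneg [simp]: "0 \<le> F2 i x"
  by (simp add: F2_def)

text \<open>The shifted heat evolves exactly except from time 1 to time 2, where its source at
  \<open>a\<close> appears. An inequality in this direction is what the maximal inequality below
  consumes.\<close>

lemma diffuse_F2: "diffuse (F2 i) x \<le> F2 (Suc i) x"
proof (cases "i < 2")
  case True
  then have "diffuse (F2 i) x = 0" by (simp add: diffuse_def F2_def)
  then show ?thesis by simp
next
  case False
  then have "Suc i - 2 = Suc (i - 2)" by simp
  with False have "F2 i = F (i - 2)" "F2 (Suc i) = F (Suc (i - 2))"
    by (auto simp: F2_def fun_eq_iff)
  then show ?thesis by (simp add: heat_Suc)
qed

lemma H_nonneg [simp]: "0 \<le> H i x"
  by (induction i arbitrary: x) (auto intro: diffuse_nonneg)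

lemma H_le: "H i x \<le> F i x"
  by (induction i arbitrary: x) (auto simp: heat_Suc intro: diffuse_mono diffuse_nonneg)

declare H.simps(2) [simp del]

lemma K_nonneg [simp]: "0 \<le> K i x"
  by (induction i arbitrary: x) (auto intro!: diffuse_nonneg)

lemma K_le: "K i x \<le> B i x"
  by (induction i arbitrary: x) (auto simp: heat_Suc intro!: diffuse_mono)

text \<open>The mask that \<open>H\<close> applies on arriving at a time is the one that
  \<open>K\<close> applies in its next step, so moving the cut only passes one mask and one step
  from one side to the other.\<close>

lemma pairing_H_K: "r \<le> k \<Longrightarrow> pairing (H (k - r)) (K r) = pairing (F 0) (K k)"
proof (induction r rule: inc_induct)
  case base
  then show ?case by simp
next
  case (step r)
  have e: "k - r = Suc (k - Suc r)" using step by simp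
  have "pairing (H (k - r)) (K r) = pairing (H (k - Suc r)) (K (Suc r))"
    using H.simps(2)[of "k - Suc r"] by (simp add: pairing_if pairing_diffuse flip: e)
  then show ?case using step by simp
qed

text \<open>
  A maximal inequality: decomposing at the last shortcut shows that the k-step walks meeting a
  shortcut weigh at most \<open>4 * \<theta>\<close> times all (k-2)-step walks.
\<close>

lemma pairing_F_K:
  "r \<le> k \<Longrightarrow> m + 4 * \<theta> * pairing (F2 (k - r)) (K r)
     \<le> pairing (F (k - r)) (K r) + 4 * \<theta> * pairing (F2 k) (B 0)"
proof (induction r)
  case 0
  then show ?case using pairing_heat[OF a_state, of k b 0] by (simp add: m_def)
next
  case (Suc r)
  let ?j = "k - Suc r"
  have e: "k - r = Suc ?j" using Suc by simp
  let ?N = "\<lambda>x. if shortcut (k - r) x then 0 else K r x"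
  let ?M = "\<lambda>x. if shortcut (k - r) x then K r x else 0"
  have 1: "pairing (F (k - r)) (K r) = pairing (F ?j) (K (Suc r)) + pairing (F (k - r)) ?M"
    by (subst pairing_split[where P = "shortcut (k - r)"]) (simp add: e heat_Suc pairing_diffuse)
  have 2: "pairing (F (k - r)) ?M \<le> 4 * \<theta> * pairing (F2 (k - r)) ?M"
    unfolding pairing_def sum_distrib_left
  proof (rule sum_mono)
    fix x
    show "F (k - r) x * ?M x \<le> 4 * \<theta> * (F2 (k - r) x * ?M x)"
      using mult_right_mono[of "F (k - r) x" "4 * \<theta> * F2 (k - r) x" "K r x"]
      by (auto simp: shortcut_def mult_ac)
  qed
  \<comment> \<open>The walks still alive are carried one step by the subsolution property, and the
    masked ones are added back to complete \<open>K r\<close>.\<close>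
  have "pairing (F2 ?j) (K (Suc r)) = pairing (diffuse (F2 ?j)) ?N"
    by (simp add: pairing_diffuse)
  also have "\<dots> \<le> pairing (F2 (k - r)) ?N"
    unfolding e by (intro pairing_mono diffuse_F2 diffuse_nonneg) auto
  finally have "pairing (F2 ?j) (K (Suc r)) + pairing (F2 (k - r)) ?M \<le> pairing (F2 (k - r)) (K r)"
    by (subst pairing_split[where P = "shortcut (k - r)" and g = "K r"]) simp
  then have 3: "4 * \<theta> * (pairing (F2 ?j) (K (Suc r)) + pairing (F2 (k - r)) ?M) \<le> 4 * \<theta> * pairing (F2 (k - r)) (K r)"
    using \<theta>_pos by (intro mult_left_mono) auto
  show ?case using Suc 1 2 3 by (simp add: algebra_simps)
qed

text \<open>By the maximal inequality and \<open>shorter\<close>, shortcuts destroy at most a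
  quarter of the mass. Moving the cut to time j and then dropping the restriction after j can only
  increase the weight.\<close>

lemma pairing_H_B:
  assumes "j \<le> k"
  shows "3/4 * m \<le> pairing (H j) (B (k - j))"
proof -
  have s: "16 * \<theta> * pairing (F2 k) (B 0) \<le> m"
  proof (cases "k < 2")
    case True
    then show ?thesis using m_pos by (simp add: F2_def pairing_def)
  next
    case False
    then have "F2 k = F (k - 2)" by (simp add: F2_def fun_eq_iff)
    then show ?thesis using shorter False pairing_heat[OF a_state, of "k - 2" b 0] by simp
  qed
  have "0 \<le> pairing (F2 0) (K k)"
    by (rule pairing_nonneg) auto
  then have "0 \<le> 4 * \<theta> * pairing (F2 0) (K k)"
    using \<theta>_pos by simp
  then have "m - m / 4 \<le> pairing (F 0) (K k)"
    using pairing_F_K[of k] s by simp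
  also have "\<dots> = pairing (H j) (K (k - j))"
    using pairing_H_K[of "k - j"] assms by simp
  also have "\<dots> \<le> pairing (H j) (B (k - j))"
    by (intro pairing_mono K_le) auto
  finally show ?thesis by simp
qed

text \<open>The weight of the (k+2)-step walks whose first shortcut is at time j + 1.\<close>

definition first_shortcut :: "nat \<Rightarrow> real" where
  "first_shortcut j = pairing (diffuse (H j)) (\<lambda>x. if shortcut (Suc j) x then B (k + 1 - j) x else 0)"

lemma first_shortcut_nonneg: "0 \<le> first_shortcut j"
  unfolding first_shortcut_def by (intro pairing_nonneg diffuse_nonneg) auto

text \<open>A walk has at most one first shortcut, so these weights add up to at most the total
  (k+2)-step mass. The induction peels off one time at a time.\<close>

lemma sum_first_shortcut: "(\<Sum>j\<le>k. first_shortcut j) \<le> \<theta> * m"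
proof -
  have "i \<le> k + 1 \<Longrightarrow> (\<Sum>j<i. first_shortcut j) + pairing (H i) (B (k + 2 - i)) = B (k + 2) a" for i
  proof (induction i)
    case 0
    then show ?case using pairing_heat[OF a_state, of 0 b "k + 2"] by simp
  next
    case (Suc i)
    have e: "k + 2 - i = Suc (k + 1 - i)" and e': "k + 2 - Suc i = k + 1 - i" using Suc by simp_all
    have "pairing (H i) (B (k + 2 - i)) = pairing (diffuse (H i)) (B (k + 1 - i))"
      unfolding e heat_Suc by (simp add: pairing_diffuse)
    also have "\<dots> = pairing (H (Suc i)) (B (k + 2 - Suc i)) + first_shortcut i"
      unfolding first_shortcut_def e' H.simps pairing_if by (rule pairing_split)
    finally show ?case using Suc by simp
  qed
  from this[of "k + 1"] have "(\<Sum>j<k + 1. first_shortcut j) + pairing (H (k + 1)) (B 1) = B (k + 2) a"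
    by simp
  moreover have "0 \<le> pairing (H (k + 1)) (B 1)"
    by (intro pairing_nonneg) auto
  ultimately show ?thesis
    using longer by (simp add: lessThan_Suc_atMost)
qed

section \<open>Splicing and the logarithmic inequality\<close>

definition edge :: "nat \<Rightarrow> 'a \<Rightarrow> 'a \<Rightarrow> real" where
  "edge i x y = F i x * S x y * B (k - Suc i) y"

text \<open>A potential whose increment along an edge is the logarithm of the splice factor r; this
  is why the factors telescope.\<close>

definition \<phi> :: "nat \<Rightarrow> 'a \<Rightarrow> real" where
  "\<phi> i x = ln (F i x) - ln (B (k - i) x)"

text \<open>
  The probability that a walk spliced at the edge (x, y), with its prefix redrawn among the walks from
  \<open>a\<close> to \<open>y\<close>, has its first shortcut right after the splice.
\<close>

definition spliced :: "nat \<Rightarrow> 'a \<Rightarrow> 'a \<Rightarrow> real" where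
  "spliced i x y = of_bool (shortcut (i + 2) x) * (H (Suc i) y / F (Suc i) y)"

lemma diffuse_pos:
  assumes "x \<in> \<Omega>" "y \<in> \<Omega>" "0 < S x y" "0 < f y" "\<And>z. 0 \<le> f z"
  shows "0 < diffuse f x"
proof -
  have "0 < S x y * f y" using assms by simp
  also have "\<dots> \<le> diffuse f x"
    unfolding diffuse_def using assms by (intro member_le_sum) auto
  finally show ?thesis .
qed

text \<open>The tangent bound ln u \<le> u - 1 is used at u = k r / \<theta> with weight
  \<open>spliced i x y\<close> and at u = r / \<theta> with the remaining weight. The factor k
  yields the gain ln k; it is affordable because splices of the first kind are told apart by their
  first shortcut.\<close>

lemma edge_inequality:
  assumes "i < k" "x \<in> \<Omega>" "y \<in> \<Omega>"
  shows "edge i x y * (1 - ln \<theta>) + (edge i x y * \<phi> (Suc i) y - edge i x y * \<phi> i x) + edge i x y * spliced i x y * ln k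
    \<le> k / \<theta> * (of_bool (shortcut (i + 2) x) * H (Suc i) y * S x y * B (k - i) x)
      + 1 / \<theta> * (F (Suc i) y * S x y * B (k - i) x)"
\<comment> \<open>Edges of weight zero are set aside, since the logarithms carry meaning only where
  the heats are positive.\<close>
proof (cases "edge i x y = 0")
  case True
  moreover have "0 \<le> k / \<theta> * (of_bool (shortcut (i + 2) x) * H (Suc i) y * S x y * B (k - i) x)
      + 1 / \<theta> * (F (Suc i) y * S x y * B (k - i) x)"
    using \<theta>_pos by (intro add_nonneg_nonneg mult_nonneg_nonneg) (auto simp del: H.simps)
  ultimately show ?thesis by simp
next
  case False
  then have pos: "0 < F i x" "0 < S x y" "0 < B (k - Suc i) y"
    unfolding edge_def by (auto simp: less_le)
  have e: "k - i = Suc (k - Suc i)" using assms by simp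
  have pos': "0 < F (Suc i) y" "0 < B (k - i) x"
    using assms pos diffuse_pos[of y x "F i"] diffuse_pos[of x y "B (k - Suc i)"]
    unfolding e by (auto simp: heat_Suc kernel_sym)
  define r where "r = F (Suc i) y * B (k - i) x / (F i x * B (k - Suc i) y)"
  define d where "d = spliced i x y"
  have r: "0 < r" using pos pos' by (simp add: r_def)
  have d: "0 \<le> d" "d \<le> 1"
    using H_le[of "Suc i" y] pos' by (auto simp: d_def spliced_def simp del: H.simps)
  have ln_r: "ln r = \<phi> (Suc i) y - \<phi> i x"
    using pos pos' by (simp add: r_def \<phi>_def ln_div ln_mult)
  have er: "edge i x y * r = F (Suc i) y * S x y * B (k - i) x"
    using pos by (simp add: edge_def r_def)
  have erd: "edge i x y * r * d = of_bool (shortcut (i + 2) x) * H (Suc i) y * S x y * B (k - i) x"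
    unfolding er using pos' by (simp add: d_def spliced_def)
  have k: "1 \<le> real k" using k_pos by simp
  have "1 + ln (k * r / \<theta>) \<le> k * r / \<theta>" "1 + ln (r / \<theta>) \<le> r / \<theta>"
    using ln_le_minus_one[of "k * r / \<theta>"] ln_le_minus_one[of "r / \<theta>"] r k \<theta>_pos by auto
  moreover have "ln (k * r / \<theta>) = ln k + ln r - ln \<theta>" "ln (r / \<theta>) = ln r - ln \<theta>"
    using r k \<theta>_pos by (auto simp: ln_div ln_mult)
  ultimately have l: "1 + (ln k + ln r - ln \<theta>) \<le> k * r / \<theta>" "1 + (ln r - ln \<theta>) \<le> r / \<theta>"
    by auto
  have "1 - ln \<theta> + ln r + d * ln k = d * (1 + (ln k + ln r - ln \<theta>)) + (1 - d) * (1 + (ln r - ln \<theta>))"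
    by (simp add: algebra_simps)
  also have "\<dots> \<le> d * (k * r / \<theta>) + (1 - d) * (r / \<theta>)"
    using l d by (intro add_mono mult_left_mono) auto
  also have "\<dots> \<le> d * (k * r / \<theta>) + 1 * (r / \<theta>)"
    using d r \<theta>_pos by (intro add_mono mult_right_mono) auto
  finally have "edge i x y * (1 - ln \<theta> + ln r + d * ln k) \<le> edge i x y * (d * (k * r / \<theta>) + 1 * (r / \<theta>))"
    using pos by (intro mult_left_mono) (auto simp: edge_def)
  also have "\<dots> = k / \<theta> * (edge i x y * r * d) + 1 / \<theta> * (edge i x y * r)"
    by (simp add: algebra_simps)
  finally show ?thesis
    unfolding erd unfolding er ln_r d_def by (simp only: distrib_left right_diff_distrib mult.assoc)
qed

lemma sum_edge_left: "i < k \<Longrightarrow> (\<Sum>x\<in>\<Omega>. \<Sum>y\<in>\<Omega>. edge i x y * g x) = pairing (F i) (\<lambda>x. B (k - i) x * g x)"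
proof -
  assume "i < k"
  then have "k - i = Suc (k - Suc i)" by simp
  then show ?thesis
    unfolding pairing_def
    by (simp add: heat_Suc diffuse_def edge_def sum_distrib_left sum_distrib_right mult_ac)
qed

lemma sum_edge_right: "(\<Sum>x\<in>\<Omega>. \<Sum>y\<in>\<Omega>. edge i x y * g y) = pairing (F (Suc i)) (\<lambda>y. B (k - Suc i) y * g y)"
  unfolding pairing_def
  by (subst sum.swap)
    (simp add: heat_Suc diffuse_def edge_def sum_distrib_left sum_distrib_right kernel_sym mult_ac)

lemma pairing_F_B: "i + j = t \<Longrightarrow> pairing (F i) (B j) = B t a"
  using pairing_heat[OF a_state] by auto

lemma sum_edge: "i < k \<Longrightarrow> (\<Sum>x\<in>\<Omega>. \<Sum>y\<in>\<Omega>. edge i x y) = m"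
  using sum_edge_left[of i "\<lambda>_. 1"] pairing_F_B[of i "k - i" k] by (simp add: m_def)

text \<open>Shortcut-free prefixes keep at least 3/4 of the mass by \<open>pairing_H_B\<close>.
  Where \<open>x\<close> is not a shortcut, the heat at time i + 2 exceeds 4 * \<theta> times that
  at time i, so by \<open>longer\<close> such edges carry at most 1/4; half of the mass
  remains.\<close>

lemma sum_edge_spliced:
  assumes "i < k"
  shows "m / 2 \<le> (\<Sum>x\<in>\<Omega>. \<Sum>y\<in>\<Omega>. edge i x y * spliced i x y)"
proof -
  have F_B: "pairing (F (i + 2)) (B (k - i)) \<le> \<theta> * m"
    using longer pairing_F_B[of "i + 2" "k - i" "k + 2"] assms by simp
  let ?u = "\<lambda>x. of_bool (\<not> shortcut (i + 2) x) :: real"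
  have "4 * \<theta> * pairing (F i) (\<lambda>x. B (k - i) x * ?u x) \<le> pairing (F (i + 2)) (B (k - i))"
    unfolding pairing_def sum_distrib_left
  proof (rule sum_mono)
    fix x
    have "F2 (i + 2) x = F i x" by (simp add: F2_def)
    then show "4 * \<theta> * (F i x * (B (k - i) x * ?u x)) \<le> F (i + 2) x * B (k - i) x"
      using mult_right_mono[of "4 * \<theta> * F i x" "F (i + 2) x" "B (k - i) x"]
      by (auto simp: shortcut_def mult_ac)
  qed
  with F_B have "\<theta> * (4 * pairing (F i) (\<lambda>x. B (k - i) x * ?u x)) \<le> \<theta> * m"
    by (simp add: mult_ac)
  then have 1: "4 * (\<Sum>x\<in>\<Omega>. \<Sum>y\<in>\<Omega>. edge i x y * ?u x) \<le> m"
    using \<theta>_pos assms by (simp only: sum_edge_left mult_le_cancel_left_pos)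
  let ?h = "\<lambda>y. H (Suc i) y / F (Suc i) y"
  \<comment> \<open>\<open>H\<close> vanishes wherever \<open>F\<close> does, so the convention 0 /
    0 = 0 loses nothing.\<close>
  have "F (Suc i) y * (B (k - Suc i) y * ?h y) = H (Suc i) y * B (k - Suc i) y" for y
    using H_le[of "Suc i" y] H_nonneg[of "Suc i" y] by (cases "F (Suc i) y = 0") auto
  then have "(\<Sum>x\<in>\<Omega>. \<Sum>y\<in>\<Omega>. edge i x y * ?h y) = pairing (H (Suc i)) (B (k - Suc i))"
    unfolding sum_edge_right by (simp add: pairing_def)
  then have 2: "3/4 * m \<le> (\<Sum>x\<in>\<Omega>. \<Sum>y\<in>\<Omega>. edge i x y * ?h y)"
    using pairing_H_B[of "Suc i"] assms by simp
  have "edge i x y * ?h y \<le> edge i x y * spliced i x y + edge i x y * ?u x" for x y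
  proof -
    have "?h y \<le> 1"
      using H_le[of "Suc i" y] heat_nonneg[of a "Suc i" y] by (auto simp: divide_le_eq_1 simp del: heat_nonneg)
    then have "?h y \<le> spliced i x y + ?u x" by (auto simp: spliced_def)
    then have "edge i x y * ?h y \<le> edge i x y * (spliced i x y + ?u x)"
      by (intro mult_left_mono) (auto simp: edge_def)
    then show ?thesis by (simp add: algebra_simps)
  qed
  then have "(\<Sum>x\<in>\<Omega>. \<Sum>y\<in>\<Omega>. edge i x y * ?h y)
      \<le> (\<Sum>x\<in>\<Omega>. \<Sum>y\<in>\<Omega>. edge i x y * spliced i x y + edge i x y * ?u x)"
    by (intro sum_mono)
  also have "\<dots> = (\<Sum>x\<in>\<Omega>. \<Sum>y\<in>\<Omega>. edge i x y * spliced i x y) + (\<Sum>x\<in>\<Omega>. \<Sum>y\<in>\<Omega>. edge i x y * ?u x)"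
    by (simp only: sum.distrib)
  finally show ?thesis using 1 2 by linarith
qed

text \<open>The potential averaged over all k-step walks at time i, times m. It is the same whether
  the state is read as the end of one edge or the start of the next.\<close>

definition \<Phi> :: "nat \<Rightarrow> real" where
  "\<Phi> i = pairing (F i) (\<lambda>x. B (k - i) x * \<phi> i x)"

text \<open>Summed over edges, the weights of the splices become
  \<open>first_shortcut (Suc i)\<close> for the distinguished ones and the full (k+2)-step mass, at
  most \<theta> * m, for all of them.\<close>

lemma layer_inequality:
  assumes "i < k"
  shows "m * (1 - ln \<theta>) + (\<Phi> (Suc i) - \<Phi> i) + m / 2 * ln k \<le> k / \<theta> * first_shortcut (Suc i) + m"
proof -
  have "m / 2 * ln k \<le> (\<Sum>x\<in>\<Omega>. \<Sum>y\<in>\<Omega>. edge i x y * spliced i x y) * ln k"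
    using sum_edge_spliced[OF assms] k_pos by (intro mult_right_mono) auto
  then have "m * (1 - ln \<theta>) + (\<Phi> (Suc i) - \<Phi> i) + m / 2 * ln k
    \<le> (\<Sum>x\<in>\<Omega>. \<Sum>y\<in>\<Omega>. edge i x y) * (1 - ln \<theta>)
      + ((\<Sum>x\<in>\<Omega>. \<Sum>y\<in>\<Omega>. edge i x y * \<phi> (Suc i) y) - (\<Sum>x\<in>\<Omega>. \<Sum>y\<in>\<Omega>. edge i x y * \<phi> i x))
      + (\<Sum>x\<in>\<Omega>. \<Sum>y\<in>\<Omega>. edge i x y * spliced i x y) * ln k"
    unfolding sum_edge[OF assms] sum_edge_left[OF assms] sum_edge_right \<Phi>_def by simp
  also have "\<dots> = (\<Sum>x\<in>\<Omega>. \<Sum>y\<in>\<Omega>. edge i x y * (1 - ln \<theta>) + (edge i x y * \<phi> (Suc i) y - edge i x y * \<phi> i x)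
      + edge i x y * spliced i x y * ln k)"
    by (simp only: sum.distrib sum_subtractf sum_distrib_right)
  also have "\<dots> \<le> (\<Sum>x\<in>\<Omega>. \<Sum>y\<in>\<Omega>. k / \<theta> * (of_bool (shortcut (i + 2) x) * H (Suc i) y * S x y * B (k - i) x)
      + 1 / \<theta> * (F (Suc i) y * S x y * B (k - i) x))"
    by (intro sum_mono edge_inequality assms)
  also have "\<dots> = k / \<theta> * (\<Sum>x\<in>\<Omega>. \<Sum>y\<in>\<Omega>. of_bool (shortcut (i + 2) x) * H (Suc i) y * S x y * B (k - i) x)
      + 1 / \<theta> * (\<Sum>x\<in>\<Omega>. \<Sum>y\<in>\<Omega>. F (Suc i) y * S x y * B (k - i) x)"
    by (simp only: sum.distrib sum_distrib_left)
  also have "(\<Sum>x\<in>\<Omega>. \<Sum>y\<in>\<Omega>. of_bool (shortcut (i + 2) x) * H (Suc i) y * S x y * B (k - i) x) = first_shortcut (Suc i)"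
    unfolding first_shortcut_def pairing_def diffuse_def sum_distrib_right
    by (intro sum.cong refl) auto
  also have "(\<Sum>x\<in>\<Omega>. \<Sum>y\<in>\<Omega>. F (Suc i) y * S x y * B (k - i) x) = pairing (F (i + 2)) (B (k - i))"
    unfolding pairing_def add_2_eq_Suc' heat_Suc[of _ "Suc i"] diffuse_def[of "F (Suc i)"] sum_distrib_right
    by (simp add: mult_ac)
  also have "\<dots> = B (k + 2) a"
    using assms by (intro pairing_F_B) simp
  also have "1 / \<theta> * B (k + 2) a \<le> m"
    using longer \<theta>_pos by (simp add: field_simps)
  finally show ?thesis by simp
qed

text \<open>Over all layers \<open>\<Phi>\<close> telescopes from - m ln m to m ln m. The
  first-shortcut weights total at most \<theta> * m, so the factor k / \<theta> costs only k * m,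
  against a gain of k * m / 2 * ln k.\<close>

theorem bridge_mass_bound: "ln m \<le> k / 2 * (1 + ln \<theta> - ln k / 2)"
proof -
  have \<Phi>0: "\<Phi> 0 = - m * ln m"
  proof -
    have "\<Phi> 0 = B k a * \<phi> 0 a"
      unfolding \<Phi>_def pairing_def using a_state by (simp add: heat_0 if_distrib cong: if_cong)
    then show ?thesis by (simp add: \<phi>_def heat_0 m_def)
  qed
  have Fk: "F k b = m"
    using pairing_F_B[of k 0 k] b_state by (simp add: pairing_def heat_0 m_def if_distrib cong: if_cong)
  have \<Phi>k: "\<Phi> k = m * ln m"
  proof -
    have "\<Phi> k = F k b * \<phi> k b"
      unfolding \<Phi>_def pairing_def using b_state by (simp add: heat_0 of_bool_def if_distrib if_distribR cong: if_cong)
    then show ?thesis by (simp add: \<phi>_def heat_0 Fk)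
  qed
  have "(\<Sum>i<k. m * (1 - ln \<theta>) + (\<Phi> (Suc i) - \<Phi> i) + m / 2 * ln k)
      \<le> (\<Sum>i<k. k / \<theta> * first_shortcut (Suc i) + m)"
    by (intro sum_mono layer_inequality) auto
  then have "k * (m * (1 - ln \<theta>)) + 2 * (m * ln m) + k * (m / 2 * ln k)
      \<le> k / \<theta> * (\<Sum>i<k. first_shortcut (Suc i)) + k * m"
    by (simp add: sum.distrib sum_lessThan_telescope \<Phi>0 \<Phi>k sum_distrib_left)
  also have "(\<Sum>i<k. first_shortcut (Suc i)) \<le> \<theta> * m"
  proof -
    have "(\<Sum>j\<le>k. first_shortcut j) = first_shortcut 0 + (\<Sum>i<k. first_shortcut (Suc i))"
      by (rule sum.atMost_shift)
    then show ?thesis using sum_first_shortcut first_shortcut_nonneg[of 0] by linarith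
  qed
  then have "k / \<theta> * (\<Sum>i<k. first_shortcut (Suc i)) \<le> k / \<theta> * (\<theta> * m)"
    using \<theta>_pos by (intro mult_left_mono) auto
  also have "\<dots> = k * m"
    using \<theta>_pos by simp
  finally have "m * (k * (1 - ln \<theta>) + 2 * ln m + k / 2 * ln k) \<le> m * (2 * k)"
    by (simp add: algebra_simps)
  then have "k * (1 - ln \<theta>) + 2 * ln m + k / 2 * ln k \<le> 2 * k"
    using m_pos by (simp only: mult_le_cancel_left_pos)
  then show ?thesis by (simp add: algebra_simps)
qed

end

section \<open>Random walks on the cube and decision trees\<close>

definition flip :: "nat \<Rightarrow> bool list \<Rightarrow> bool list" where
  "flip i x = x[i := \<not> x ! i]"

lemma length_flip [simp]: "length (flip i x) = length x"
  by (simp add: flip_def)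

lemma ip2_flip:
  assumes "i < length x"
  shows "ip2 (flip i x) q \<longleftrightarrow> ip2 x q \<noteq> (i < length q \<and> q ! i)"
proof -
  let ?A = "\<lambda>x. {j. j < length x \<and> j < length q \<and> x ! j \<and> q ! j}"
  have fin: "finite (?A y)" for y by simp
  show ?thesis
  proof (cases "i < length q \<and> q ! i")
    case False
    then have "?A (flip i x) = ?A x" using assms by (auto simp: flip_def nth_list_update)
    then show ?thesis using False by (simp add: ip2_def)
  next
    case q: True
    show ?thesis
    proof (cases "x ! i")
      case True
      then have A: "?A x = insert i (?A (flip i x))" and i: "i \<notin> ?A (flip i x)"
        using q assms by (auto simp: flip_def nth_list_update)
      have "card (?A x) = Suc (card (?A (flip i x)))"
        unfolding A by (rule card_insert_disjoint[OF fin i])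
      then show ?thesis using q by (simp add: ip2_def)
    next
      case False
      then have A: "?A (flip i x) = insert i (?A x)" and i: "i \<notin> ?A x"
        using q assms by (auto simp: flip_def nth_list_update)
      have "card (?A (flip i x)) = Suc (card (?A x))"
        unfolding A by (rule card_insert_disjoint[OF fin i])
      then show ?thesis using q by (simp add: ip2_def)
    qed
  qed
qed

lemma count_list_True: "count_list x True = card {i. i < length x \<and> x ! i}"
  by (simp add: count_list_eq_length_filter length_filter_conv_card)

lemma count_list_flip:
  assumes "i < length x" "\<not> x ! i"
  shows "count_list (flip i x) True = Suc (count_list x True)"
proof -
  have "{j. j < length (flip i x) \<and> flip i x ! j} = insert i {j. j < length x \<and> x ! j}"
    using assms by (auto simp: flip_def nth_list_update)
  then show ?thesis using assms by (simp add: count_list_True)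
qed

section \<open>Expectations under the coordinate-flipping walk\<close>

primrec walk :: "nat \<Rightarrow> nat \<Rightarrow> (bool list \<Rightarrow> real) \<Rightarrow> bool list \<Rightarrow> real" where
  "walk n 0 g x = g x"
| "walk n (Suc t) g x = (\<Sum>i<n. walk n t g (flip i x)) / n"

lemma walk_add: "walk n t (\<lambda>x. g x + h x) x = walk n t g x + walk n t h x"
  by (induction t arbitrary: x) (auto simp: sum.distrib add_divide_distrib)

lemma walk_minus: "walk n t (\<lambda>x. - g x) x = - walk n t g x"
  by (induction t arbitrary: x) (auto simp: sum_negf)

lemma walk_const: "0 < n \<Longrightarrow> walk n t (\<lambda>x. c) x = c"
  by (induction t arbitrary: x) auto

lemma walk_mono:
  "(\<And>x. length x = n \<Longrightarrow> g x \<le> h x) \<Longrightarrow> length x = n \<Longrightarrow> walk n t g x \<le> walk n t h x"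
  by (induction t arbitrary: x) (auto intro!: divide_right_mono sum_mono)

lemma walk_of_bool_bounds:
  assumes "0 < n"
  shows "0 \<le> walk n t (\<lambda>x. of_bool (P x)) x" "walk n t (\<lambda>x. of_bool (P x)) x \<le> 1"
proof -
  show "0 \<le> walk n t (\<lambda>x. of_bool (P x)) x"
    by (induction t arbitrary: x) (auto intro!: divide_nonneg_nonneg sum_nonneg)
  show "walk n t (\<lambda>x. of_bool (P x)) x \<le> 1"
  proof (induction t arbitrary: x)
    case (Suc t)
    have "(\<Sum>i<n. walk n t (\<lambda>x. of_bool (P x)) (flip i x)) \<le> (\<Sum>i<n. 1)"
      by (intro sum_mono Suc)
    then show ?case using assms by (simp add: divide_le_eq)
  qed simp
qed

text \<open>As long as every flip has set a fresh coordinate, the flip after u steps hits a set one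
  with probability (j + u) / n; the bound sums this over u < t.\<close>

lemma walk_collision:
  assumes "0 < n" "length x = n" "count_list x True = j"
  shows "walk n t (\<lambda>x. of_bool (count_list x True \<noteq> j + t)) x \<le> (t * j + t * (real t - 1) / 2) / n"
  using assms(2,3)
proof (induction t arbitrary: x j)
  case (Suc t)
  let ?g = "\<lambda>x. of_bool (count_list x True \<noteq> j + Suc t) :: real"
  let ?c = "(t * Suc j + t * (real t - 1) / 2) / n :: real"
  have "walk n t ?g (flip i x) \<le> ?c + of_bool (x ! i)" if "i < n" for i
  \<comment> \<open>A first flip that clears a set coordinate is charged the full probability 1;
    this happens for j of the n choices.\<close>
  proof (cases "x ! i")
    case True
    have "0 \<le> real t * (real t - 1)" by (cases t) auto
    then have "0 \<le> ?c" by simp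
    moreover note walk_of_bool_bounds(2)[OF assms(1), of t "\<lambda>x. count_list x True \<noteq> j + Suc t" "flip i x"]
    ultimately show ?thesis using True by (simp only: of_bool_eq)
  next
    case False
    with that Suc show ?thesis
      using Suc.IH[of "flip i x" "Suc j"] by (simp add: count_list_flip algebra_simps)
  qed
  then have "(\<Sum>i<n. walk n t ?g (flip i x)) \<le> (\<Sum>i<n. ?c + of_bool (x ! i))"
    by (intro sum_mono) auto
  also have "\<dots> = n * ?c + j"
    using Suc.prems by (simp add: sum.distrib of_bool_def sum.If_cases count_list_True Int_def)
  finally have "walk n (Suc t) ?g x \<le> (n * ?c + j) / n"
    by (simp add: divide_right_mono)
  also have "\<dots> = (Suc t * j + Suc t * (real (Suc t) - 1) / 2) / n"
    using assms(1) by (simp add: field_simps)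
  finally show ?case by (simp add: algebra_simps)
qed simp

lemma expectation_walk:
  fixes D :: "pdt pmf"
  assumes "0 < n"
  shows "measure_pmf.expectation D (\<lambda>T. walk n t (\<lambda>x. of_bool (pdt_eval T x)) x)
    = walk n t (\<lambda>x. measure_pmf.prob D {T. pdt_eval T x}) x"
    and "integrable (measure_pmf D) (\<lambda>T. walk n t (\<lambda>x. of_bool (pdt_eval T x)) x)"
proof -
  show int: "integrable (measure_pmf D) (\<lambda>T. walk n t (\<lambda>x. of_bool (pdt_eval T x)) x)" for t x
    using walk_of_bool_bounds[OF assms]
    by (intro measure_pmf.integrable_const_bound[where B = 1]) auto
  show "measure_pmf.expectation D (\<lambda>T. walk n t (\<lambda>x. of_bool (pdt_eval T x)) x)
    = walk n t (\<lambda>x. measure_pmf.prob D {T. pdt_eval T x}) x"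
  proof (induction t arbitrary: x)
    case 0
    have "(\<lambda>T. of_bool (pdt_eval T x)) = (indicator {T. pdt_eval T x} :: pdt \<Rightarrow> real)"
      by (auto simp: indicator_def)
    then show ?case by simp
  next
    case (Suc t)
    then show ?case using int by simp
  qed
qed

declare walk.simps(2) [simp del]

section \<open>Syndromes and the projected walk\<close>

definition syndrome :: "bool list list \<Rightarrow> bool list \<Rightarrow> bool list" where
  "syndrome qs x = map (ip2 x) qs"

text \<open>A step adds a uniformly chosen column of the matrix with rows \<open>qs\<close>. Asking
  the column to equal the xor of the two syndromes makes the symmetry visible.\<close>

definition syndrome_kernel :: "nat \<Rightarrow> bool list list \<Rightarrow> bool list \<Rightarrow> bool list \<Rightarrow> real" where
  "syndrome_kernel n qs z w =
     card {i. i < n \<and> map2 (\<noteq>) z w = map (\<lambda>q. i < length q \<and> q ! i) qs} / n"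

abbreviation syndromes :: "bool list list \<Rightarrow> bool list set" where
  "syndromes qs \<equiv> {z. length z = length qs}"

lemma symmetric_syndrome_kernel: "symmetric_kernel (syndromes qs) (syndrome_kernel n qs)"
proof
  show "finite (syndromes qs)"
    using finite_lists_length_eq[of "UNIV :: bool set" "length qs"] by simp
  have "map2 (\<noteq>) z w = map2 (\<noteq>) w (z :: bool list)" for z w
    by (rule nth_equalityI) auto
  then show "syndrome_kernel n qs x y = syndrome_kernel n qs y x" for x y
    unfolding syndrome_kernel_def by metis
qed (simp add: syndrome_kernel_def)

lemma syndrome_flip_iff:
  assumes "i < length x" "length w = length qs"
  shows "map2 (\<noteq>) (syndrome qs x) w = map (\<lambda>q. i < length q \<and> q ! i) qs \<longleftrightarrow> w = syndrome qs (flip i x)"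
  using assms by (auto simp: list_eq_iff_nth_eq syndrome_def ip2_flip)

text \<open>Flipping coordinate i changes the syndrome by column i, whatever the current vector, so
  the projected walk is again Markov.\<close>

lemma walk_syndrome:
  assumes "length x = n" "length b = length qs"
  shows "walk n t (\<lambda>x. of_bool (syndrome qs x = b)) x
    = symmetric_kernel.heat (syndromes qs) (syndrome_kernel n qs) b t (syndrome qs x)"
proof -
  interpret symmetric_kernel "syndromes qs" "syndrome_kernel n qs"
    by (rule symmetric_syndrome_kernel)
  have "diffuse f (syndrome qs x) = (\<Sum>i<n. f (syndrome qs (flip i x))) / n" if "length x = n" for f x
  proof -
    have "syndrome_kernel n qs (syndrome qs x) w * f w
        = (\<Sum>i<n. of_bool (w = syndrome qs (flip i x)) * f w) / n" if "w \<in> syndromes qs" for w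
    proof -
      have "{i. i < n \<and> map2 (\<noteq>) (syndrome qs x) w = map (\<lambda>q. i < length q \<and> q ! i) qs}
          = {i. i < n \<and> w = syndrome qs (flip i x)}"
        using that \<open>length x = n\<close> by (intro Collect_cong conj_cong refl syndrome_flip_iff) auto
      moreover have "real (card {i. i < n \<and> w = syndrome qs (flip i x)}) = (\<Sum>i<n. of_bool (w = syndrome qs (flip i x)))"
        by (simp add: of_bool_def sum.If_cases Int_def)
      ultimately have "syndrome_kernel n qs (syndrome qs x) w
          = (\<Sum>i<n. of_bool (w = syndrome qs (flip i x))) / n"
        by (simp only: syndrome_kernel_def)
      then show ?thesis by (simp only: sum_distrib_right times_divide_eq_left)
    qed
    moreover have point: "(\<Sum>w\<in>syndromes qs. of_bool (w = syndrome qs (flip i x)) * f w) = f (syndrome qs (flip i x))" for i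
      using finite_states
      by (subst sum.mono_neutral_right[where S = "{syndrome qs (flip i x)}"]) (auto simp: syndrome_def)
    ultimately have "diffuse f (syndrome qs x) = (\<Sum>w\<in>syndromes qs. (\<Sum>i<n. of_bool (w = syndrome qs (flip i x)) * f w) / n)"
      by (simp add: diffuse_def)
    also have "\<dots> = (\<Sum>i<n. \<Sum>w\<in>syndromes qs. of_bool (w = syndrome qs (flip i x)) * f w) / n"
      by (subst sum.swap) (simp add: sum_divide_distrib)
    also have "\<dots> = (\<Sum>i<n. f (syndrome qs (flip i x))) / n"
      by (simp only: point)
    finally show ?thesis .
  qed
  then show ?thesis
    using assms(1) by (induction t arbitrary: x) (auto simp: heat_0 heat_Suc walk.simps(2))
qed

text \<open>
  The coefficients are such that an indicator function has positive advantage only if its masses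
  satisfy the assumptions of \<open>heat_bridge\<close>.
\<close>

definition advantage :: "nat \<Rightarrow> nat \<Rightarrow> real \<Rightarrow> bool list \<Rightarrow> (bool list \<Rightarrow> real) \<Rightarrow> real" where
  "advantage n k \<theta> x g = walk n k g x - walk n (k + 2) g x / \<theta>
     - (if k < 2 then 0 else 16 * \<theta> * walk n (k - 2) g x)"

lemma advantage_add:
  "advantage n k \<theta> x (\<lambda>x. g x + h x) = advantage n k \<theta> x g + advantage n k \<theta> x h"
  by (simp add: advantage_def walk_add algebra_simps add_divide_distrib)

text \<open>If the masses satisfy \<open>heat_bridge\<close>, its bound applies to the leading term
  and the penalties only help. If one of its mass conditions fails, the leading mass is zero or a
  single penalty outweighs it, and the advantage is at most 0.\<close>

lemma advantage_syndrome:
  assumes "0 < n" "length x = n" "length b = length qs" "1 \<le> k" "0 < \<theta>"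
  shows "advantage n k \<theta> x (\<lambda>x. of_bool (syndrome qs x = b)) \<le> exp (k / 2 * (1 + ln \<theta> - ln k / 2))"
proof -
  interpret symmetric_kernel "syndromes qs" "syndrome_kernel n qs"
    by (rule symmetric_syndrome_kernel)
  let ?g = "\<lambda>x. of_bool (syndrome qs x = b) :: real"
  let ?a = "syndrome qs x"
  have w: "walk n t ?g x = heat b t ?a" for t
    using assms by (intro walk_syndrome) auto
  show ?thesis
  proof (cases "0 < heat b k ?a \<and> heat b (k + 2) ?a \<le> \<theta> * heat b k ?a
      \<and> (2 \<le> k \<longrightarrow> 16 * \<theta> * heat b (k - 2) ?a \<le> heat b k ?a)")
    case True
    then interpret heat_bridge "syndromes qs" "syndrome_kernel n qs" ?a b k \<theta> "heat b k ?a"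
      using assms by unfold_locales (auto simp: syndrome_def)
    have "advantage n k \<theta> x ?g \<le> heat b k ?a"
      unfolding advantage_def w using assms(5) by (auto intro: add_nonneg_nonneg simp: diff_le_eq)
    also have "\<dots> = exp (ln (heat b k ?a))"
      using True by simp
    also have "\<dots> \<le> exp (k / 2 * (1 + ln \<theta> - ln k / 2))"
      using bridge_mass_bound by (subst exp_le_cancel_iff)
    finally show ?thesis .
  next
    case False
    have nn: "0 \<le> heat b (k + 2) ?a / \<theta>" "0 \<le> 16 * \<theta> * heat b (k - 2) ?a" "0 \<le> heat b k ?a"
      using assms(5) by auto
    have "heat b k ?a = 0 \<or> heat b k ?a \<le> heat b (k + 2) ?a / \<theta>
        \<or> 2 \<le> k \<and> heat b k ?a \<le> 16 * \<theta> * heat b (k - 2) ?a"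
      using False nn(3) assms(5) by (auto simp: field_simps)
    then have "advantage n k \<theta> x ?g \<le> 0"
      unfolding advantage_def w using nn by auto
    then show ?thesis by (rule order_trans) simp
  qed
qed

text \<open>The lists \<open>qs\<close> and \<open>b\<close> record the queries and answers on the
  path to the current subtree. A node splits this fibre into two, and the advantage is additive, so
  each accepting leaf pays the bound for one fibre.\<close>

lemma advantage_tree:
  assumes "0 < n" "length x = n" "1 \<le> k" "0 < \<theta>" "length b = length qs"
  shows "advantage n k \<theta> x (\<lambda>x. of_bool (syndrome qs x = b \<and> pdt_eval T x))
    \<le> pdt_size T * exp (k / 2 * (1 + ln \<theta> - ln k / 2))"
  using assms(5)
proof (induction T arbitrary: qs b)
  case (Leaf v)
  then show ?case
    using assms advantage_syndrome[of n x b qs k \<theta>]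
    by (cases v) (auto simp: advantage_def walk_const)
next
  case (Node q l r)
  have "of_bool (syndrome qs x = b \<and> pdt_eval (Node q l r) x)
      = of_bool (syndrome (q # qs) x = False # b \<and> pdt_eval l x)
        + (of_bool (syndrome (q # qs) x = True # b \<and> pdt_eval r x) :: real)" for x
    by (auto simp: syndrome_def)
  then have "advantage n k \<theta> x (\<lambda>x. of_bool (syndrome qs x = b \<and> pdt_eval (Node q l r) x))
      = advantage n k \<theta> x (\<lambda>x. of_bool (syndrome (q # qs) x = False # b \<and> pdt_eval l x))
        + advantage n k \<theta> x (\<lambda>x. of_bool (syndrome (q # qs) x = True # b \<and> pdt_eval r x))"
    by (simp only: advantage_add)
  also have "\<dots> \<le> (pdt_size l + pdt_size r) * exp (k / 2 * (1 + ln \<theta> - ln k / 2))"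
    using Node.IH(1)[of "False # b" "q # qs"] Node.IH(2)[of "True # b" "q # qs"] Node.prems
    by (simp add: algebra_simps)
  also have "\<dots> \<le> pdt_size (Node q l r) * exp (k / 2 * (1 + ln \<theta> - ln k / 2))"
    by (intro mult_right_mono) auto
  finally show ?case .
qed

section \<open>The size bound for small error\<close>

lemma rpdt_accept_bounds:
  assumes "rpdt n \<delta> P D s" "length x = n"
  shows "P x \<Longrightarrow> 1 - \<delta> \<le> measure_pmf.prob D {T. pdt_eval T x}"
    and "\<not> P x \<Longrightarrow> measure_pmf.prob D {T. pdt_eval T x} \<le> \<delta>"
proof -
  have *: "1 - \<delta> \<le> measure_pmf.prob D {T. pdt_eval T x = P x}"
    using assms by (auto simp: rpdt_def)
  show "1 - \<delta> \<le> measure_pmf.prob D {T. pdt_eval T x}" if "P x"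
    using * that by simp
  show "measure_pmf.prob D {T. pdt_eval T x} \<le> \<delta>" if "\<not> P x"
    using * that measure_pmf.prob_compl[of "{T. pdt_eval T x}" D] by (simp add: Compl_eq Compl_eq_Diff_UNIV[symmetric])
qed

text \<open>From weight k - t, a walk without collisions has weight k exactly at time t. Thus the
  acceptance probability is near 1 at time t and near 0 at times t + 2 and t - 2, so the mean
  advantage of the trees is large, while \<open>advantage_tree\<close> bounds each of them.\<close>

lemma rpdt_advantage:
  assumes D: "rpdt n \<delta> (hw_pred n k) D s"
    and "1 \<le> t" "t \<le> k" "k \<le> n" "0 < \<delta>" "\<delta> \<le> 1 / 2 ^ 16"
    and collision: "real (t + 2) * real (k - t) + real (t + 2) * real (t + 1) / 2 \<le> 3 * \<delta> * n"
  shows "1 / 2 \<le> s * exp (t / 2 * (1 + ln (16 * \<delta>) - ln t / 2))"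
proof -
  let ?\<theta> = "16 * \<delta>"
  define x where "x = replicate (k - t) True @ replicate (n - (k - t)) False"
  have x: "length x = n" "count_list x True = k - t"
    using assms by (auto simp: x_def count_list_eq_length_filter)
  have n: "0 < n" using assms by simp
  define p where "p = (\<lambda>x. measure_pmf.prob D {T. pdt_eval T x})"
  have coll: "walk n u (\<lambda>x. of_bool (count_list x True \<noteq> (k - t) + u)) x \<le> 3 * \<delta>" if "u \<le> t + 2" for u
  proof -
    have "real u * (real u - 1) \<le> real (t + 2) * real (t + 1)"
    proof (cases u)
      case (Suc v)
      then show ?thesis using that by (intro mult_mono) auto
    qed simp
    moreover have "real u * real (k - t) \<le> real (t + 2) * real (k - t)"
      using that by (intro mult_right_mono) auto
    ultimately have "real u * real (k - t) + real u * (real u - 1) / 2 \<le> 3 * \<delta> * n"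
      using collision by linarith
    then have "(real u * real (k - t) + real u * (real u - 1) / 2) / n \<le> 3 * \<delta>"
      using n by (simp add: divide_le_eq)
    then show ?thesis
      using walk_collision[OF n x, of u] by simp
  qed
  have low: "1 - 4 * \<delta> \<le> walk n t p x"
  proof -
    have "walk n t (\<lambda>x. (1 - \<delta>) + - of_bool (count_list x True \<noteq> (k - t) + t)) x \<le> walk n t p x"
    proof (rule walk_mono)
      fix y :: "bool list" assume "length y = n"
      then show "(1 - \<delta>) + - of_bool (count_list y True \<noteq> (k - t) + t) \<le> p y"
        using rpdt_accept_bounds(1)[OF D, of y] assms(3,5)
        by (auto simp: hw_pred_def p_def intro: order_trans[OF _ measure_nonneg])
    qed (rule x)
    then show ?thesis using coll[of t] n unfolding walk_add walk_minus by (simp add: walk_const)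
  qed
  have high: "walk n u p x \<le> 4 * \<delta>" if "u \<le> t + 2" "u \<noteq> t" for u
  proof -
    have "walk n u p x \<le> walk n u (\<lambda>x. \<delta> + of_bool (count_list x True \<noteq> (k - t) + u)) x"
    proof (rule walk_mono)
      fix y :: "bool list" assume "length y = n"
      then show "p y \<le> \<delta> + of_bool (count_list y True \<noteq> (k - t) + u)"
        using rpdt_accept_bounds(2)[OF D, of y] assms(3,5) that(2)
        by (auto simp: hw_pred_def p_def intro: order_trans[OF measure_pmf.prob_le_1])
    qed (rule x)
    then show ?thesis using coll[OF that(1)] n unfolding walk_add by (simp add: walk_const)
  qed
  \<comment> \<open>The masses at times t + 2 and t - 2 are at most 4 * \<delta>. With \<theta> = 16
    * \<delta> the penalties are at most 4 * \<delta> / \<theta> = 1/4 and 16 * \<theta> * 4 *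
    \<delta> = 1024 * \<delta> * \<delta>.\<close>
  have "1 / 2 \<le> 1 - 4 * \<delta> - 1 / 4 - 1024 * \<delta> * \<delta>"
  proof -
    have "1024 * \<delta> * \<delta> \<le> 1024 * \<delta> * (1 / 2 ^ 16)"
      using assms by (intro mult_left_mono) auto
    then show ?thesis using assms(6) by simp
  qed
  also have "\<dots> \<le> advantage n t ?\<theta> x p"
  proof -
    have "walk n (t + 2) p x / ?\<theta> \<le> 1 / 4"
      using high[of "t + 2"] assms(5) by (simp add: divide_le_eq)
    moreover have "(if t < 2 then 0 else 16 * ?\<theta> * walk n (t - 2) p x) \<le> 1024 * \<delta> * \<delta>"
      using mult_left_mono[OF high[of "t - 2"], of "16 * ?\<theta>"] assms(2,5) by auto
    ultimately show ?thesis
      unfolding advantage_def using low by linarith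
  qed
  also have "\<dots> = measure_pmf.expectation D (\<lambda>T. advantage n t ?\<theta> x (\<lambda>x. of_bool (pdt_eval T x)))"
    unfolding advantage_def p_def using expectation_walk[OF n, of D] by auto
  also have "\<dots> \<le> measure_pmf.expectation D (\<lambda>_. s * exp (t / 2 * (1 + ln ?\<theta> - ln t / 2)))"
  proof (rule integral_mono_AE)
    show "integrable D (\<lambda>T. advantage n t ?\<theta> x (\<lambda>x. of_bool (pdt_eval T x)))"
      unfolding advantage_def using expectation_walk(2)[OF n] by (cases "t < 2") auto
    have "advantage n t ?\<theta> x (\<lambda>x. of_bool (pdt_eval T x)) \<le> s * exp (t / 2 * (1 + ln ?\<theta> - ln t / 2))"
      if "T \<in> set_pmf D" for T
    proof -
      have "advantage n t ?\<theta> x (\<lambda>x. of_bool (pdt_eval T x)) \<le> pdt_size T * exp (t / 2 * (1 + ln ?\<theta> - ln t / 2))"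
        using advantage_tree[OF n x(1) assms(2), of ?\<theta> "[]" "[]" T] assms(5) by (simp add: syndrome_def)
      also have "\<dots> \<le> s * exp (t / 2 * (1 + ln ?\<theta> - ln t / 2))"
        using D that by (intro mult_right_mono) (auto simp: rpdt_def)
      finally show ?thesis .
    qed
    then show "AE T in measure_pmf D. advantage n t ?\<theta> x (\<lambda>x. of_bool (pdt_eval T x)) \<le> s * exp (t / 2 * (1 + ln ?\<theta> - ln t / 2))"
      by (simp add: AE_measure_pmf_iff)
  qed simp
  finally show ?thesis by simp
qed

lemma ln2_bound: "2 \<le> 3 * ln (2::real)"
proof -
  have "exp (2::real) = exp 1 ^ 2" by (simp flip: exp_of_nat_mult)
  also have "\<dots> \<le> (2.8::real) ^ 2"
    using e_less_272 by (intro power_mono) auto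
  also have "\<dots> \<le> 8" by (simp add: power2_eq_square)
  finally have "ln (exp (2::real)) \<le> ln 8" by (subst ln_le_cancel_iff) auto
  moreover have "ln (8::real) = 3 * ln 2"
    using ln_realpow[of 2 3] by simp
  ultimately show ?thesis by simp
qed

lemma rpdt_size_bound:
  assumes D: "rpdt n \<delta> (hw_pred n k) D s"
    and t: "1 \<le> t" "t \<le> k" "k \<le> n" and \<delta>: "0 < \<delta>" "\<delta> \<le> 1 / 2 ^ 16"
    and collision: "real (t + 2) * real (k - t) + real (t + 2) * real (t + 1) / 2 \<le> 3 * \<delta> * n"
  shows "t / 4 * log 2 (t / \<delta>) \<le> log 2 s"
proof -
  let ?e = "t / 2 * (1 + ln (16 * \<delta>) - ln t / 2)"
  have adv: "1 / 2 \<le> s * exp ?e"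
    using rpdt_advantage[OF assms] .
  then have s: "0 < s" by (cases "s = 0") auto
  have "ln (1 / 2) \<le> ln (s * exp ?e)"
    using adv s by (subst ln_le_cancel_iff) auto
  then have 1: "- ln 2 \<le> ln s + ?e"
    using s by (simp add: ln_mult ln_div)
  have "ln (16 * \<delta>) = 4 * ln 2 + ln \<delta>"
    using \<delta> ln_realpow[of 2 4] by (simp add: ln_mult)
  with 1 have 2: "- ln 2 \<le> ln s + t / 2 * (1 + (4 * ln 2 + ln \<delta>) - ln t / 2)"
    by simp
  have "ln \<delta> \<le> ln (1 / 2 ^ 16)"
    using \<delta> by (subst ln_le_cancel_iff) auto
  also have "\<dots> = - 16 * ln 2"
    using ln_realpow[of 2 16] by (simp add: ln_div)
  \<comment> \<open>Half of the term t/2 * ln (1 / \<delta>) absorbs all constants, including the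
    initial ln 2; the other half stays in the result.\<close>
  finally have "2 + 12 * ln 2 + ln \<delta> \<le> 0"
    using ln2_bound by linarith
  then have "t * (2 + 12 * ln 2 + ln \<delta>) \<le> 0"
    by (simp add: mult_nonneg_nonpos)
  moreover have "ln 2 \<le> t * ln (2::real)"
    using t(1) by simp
  ultimately have "t / 4 * (ln t - ln \<delta>) \<le> ln s"
    using 2 by (simp only: ring_distribs)
  then have "t / 4 * ln (t / \<delta>) \<le> ln s"
    using t \<delta> by (simp add: ln_div)
  then show ?thesis
    by (simp add: log_def field_simps)
qed

section \<open>Error reduction\<close>

fun graft :: "pdt \<Rightarrow> (bool \<Rightarrow> pdt) \<Rightarrow> pdt" where
  "graft (Leaf b) g = g b"
| "graft (Node y l r) g = Node y (graft l g) (graft r g)"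

lemma pdt_eval_graft [simp]: "pdt_eval (graft T g) x = pdt_eval (g (pdt_eval T x)) x"
  by (induction T) auto

lemma pdt_wf_graft: "pdt_wf n T \<Longrightarrow> (\<And>b. pdt_wf n (g b)) \<Longrightarrow> pdt_wf n (graft T g)"
  by (induction T) auto

lemma pdt_size_pos: "1 \<le> pdt_size T"
  by (cases T) auto

lemma pdt_size_graft: "(\<And>b. pdt_size (g b) \<le> c) \<Longrightarrow> pdt_size (graft T g) \<le> pdt_size T * c"
proof (induction T)
  case (Node y l r)
  have "1 \<le> c" using Node.prems[of True] pdt_size_pos[of "g True"] by simp
  then show ?case using Node by (simp add: algebra_simps)
qed simp

definition maj3 :: "pdt \<times> pdt \<times> pdt \<Rightarrow> pdt" where
  "maj3 = (\<lambda>(T1, T2, T3). graft T1 (\<lambda>u. graft T2 (\<lambda>v. if u = v then Leaf u else T3)))"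

lemma maj3_correct_iff:
  "pdt_eval (maj3 (T1, T2, T3)) x = v \<longleftrightarrow>
    (pdt_eval T1 x = v, pdt_eval T2 x = v, pdt_eval T3 x = v)
      \<in> {(True, True, True), (True, True, False), (True, False, True), (False, True, True)}"
  by (auto simp: maj3_def)

text \<open>The polynomial is the probability that at least two of three independent votes, each
  right with probability p, are right. The difference factors into visibly nonnegative
  terms.\<close>

lemma majority_mono:
  fixes p q :: real
  assumes "0 \<le> q" "q \<le> p" "p \<le> 1"
  shows "q\<^sup>2 * (3 - 2 * q) \<le> p\<^sup>2 * (3 - 2 * p)"
proof -
  have "p\<^sup>2 * (3 - 2 * p) - q\<^sup>2 * (3 - 2 * q) = (p - q) * (3 * p * (1 - p) + 3 * q * (1 - q) + (p - q)\<^sup>2)"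
    by (simp add: algebra_simps power2_eq_square)
  also have "\<dots> \<ge> 0"
    using assms by (intro mult_nonneg_nonneg add_nonneg_nonneg) auto
  finally show ?thesis by simp
qed

lemma rpdt_maj3:
  assumes D: "rpdt n \<delta> P D s" and "\<delta> \<le> 1" and \<epsilon>: "3 * \<delta>\<^sup>2 - 2 * \<delta> ^ 3 \<le> \<epsilon>"
  shows "\<exists>D'. rpdt n \<epsilon> P D' (s ^ 3)"
proof -
  define D3 where "D3 = pair_pmf D (pair_pmf D D)"
  have "pdt_wf n (maj3 (T1, T2, T3)) \<and> pdt_size (maj3 (T1, T2, T3)) \<le> s ^ 3"
    if "T1 \<in> set_pmf D" "T2 \<in> set_pmf D" "T3 \<in> set_pmf D" for T1 T2 T3
  proof
    have wf: "pdt_wf n T1" "pdt_wf n T2" "pdt_wf n T3"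
      and sz: "pdt_size T1 \<le> s" "pdt_size T2 \<le> s" "pdt_size T3 \<le> s"
      using D that by (auto simp: rpdt_def)
    show "pdt_wf n (maj3 (T1, T2, T3))"
      using wf by (auto simp: maj3_def intro!: pdt_wf_graft)
    have "1 \<le> s" using sz pdt_size_pos[of T1] by simp
    then have "pdt_size (maj3 (T1, T2, T3)) \<le> pdt_size T1 * (pdt_size T2 * s)"
      using sz by (auto simp: maj3_def intro!: pdt_size_graft)
    also have "\<dots> \<le> s * (s * s)"
      using sz by (intro mult_mono) auto
    finally show "pdt_size (maj3 (T1, T2, T3)) \<le> s ^ 3"
      by (simp add: power3_eq_cube)
  qed
  then have "\<forall>T\<in>set_pmf (map_pmf maj3 D3). pdt_wf n T \<and> pdt_size T \<le> s ^ 3"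
    by (auto simp: D3_def)
  moreover have "1 - \<epsilon> \<le> measure_pmf.prob (map_pmf maj3 D3) {T. pdt_eval T x = P x}" if "length x = n" for x
  proof -
    define c where "c = (\<lambda>T. pdt_eval T x = P x)"
    define p where "p = measure_pmf.prob D {T. c T}"
    have p: "1 - \<delta> \<le> p" "0 \<le> p" "p \<le> 1"
      using D that by (auto simp: rpdt_def p_def c_def)
    have pT: "pmf (map_pmf c D) True = p"
      by (simp add: pmf_map p_def vimage_def)
    have pF: "pmf (map_pmf c D) False = 1 - p"
      using pmf_False_conv_True[of "map_pmf c D"] pT by simp
    let ?M = "{(True, True, True), (True, True, False), (True, False, True), (False, True, True)}"
    have "measure_pmf.prob (map_pmf maj3 D3) {T. pdt_eval T x = P x}
        = measure_pmf.prob D3 {(T1, T2, T3). (c T1, c T2, c T3) \<in> ?M}"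
      unfolding measure_map_pmf
      by (intro arg_cong[where f = "measure D3"]) (simp add: set_eq_iff maj3_correct_iff c_def del: insert_iff)
    also have "\<dots> = measure_pmf.prob (pair_pmf (map_pmf c D) (pair_pmf (map_pmf c D) (map_pmf c D))) ?M"
      unfolding D3_def map_pair[symmetric] measure_map_pmf
      by (intro arg_cong[where f = "measure _"]) (simp add: set_eq_iff del: insert_iff)
    also have "\<dots> = p\<^sup>2 * (3 - 2 * p)"
      by (subst measure_measure_pmf_finite) (auto simp: pmf_pair pT pF power2_eq_square algebra_simps)
    also have "\<dots> \<ge> (1 - \<delta>)\<^sup>2 * (3 - 2 * (1 - \<delta>))"
      using p assms(2) by (intro majority_mono) auto
    also have "(1 - \<delta>)\<^sup>2 * (3 - 2 * (1 - \<delta>)) = 1 - (3 * \<delta>\<^sup>2 - 2 * \<delta> ^ 3)"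
      by (simp add: power2_eq_square power3_eq_cube algebra_simps)
    finally show ?thesis using \<epsilon> by simp
  qed
  ultimately have "rpdt n \<epsilon> P (map_pmf maj3 D3) (s ^ 3)"
    unfolding rpdt_def by blast
  then show ?thesis ..
qed

lemma rpdt_mono: "rpdt n \<delta> P D s \<Longrightarrow> \<delta> \<le> \<epsilon> \<Longrightarrow> rpdt n \<epsilon> P D s"
  by (force simp: rpdt_def)

lemma rpdt_amplify:
  assumes "rpdt n \<delta> P D s" "\<delta> \<le> 1 / 3"
  shows "\<exists>D'. rpdt n (1 / 2 ^ 16) P D' (s ^ 729)"
proof -
  have step: "\<exists>D'. rpdt n \<epsilon> P D' (s' ^ 3)"
    if "\<exists>D. rpdt n \<delta> P D s'" "\<delta> \<le> 1" "3 * \<delta>\<^sup>2 - 2 * \<delta> ^ 3 \<le> \<epsilon>" for \<delta> \<epsilon> s'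
    using that rpdt_maj3 by blast
  have "\<exists>D. rpdt n (1 / 3) P D s"
    using assms rpdt_mono by blast
  \<comment> \<open>Each numeral rounds up 3\<delta>^2 - 2\<delta>^3 at its predecessor. Six rounds
    bring 1/3 below 1 / 2 ^ 16 and cube the size six times, whence 729 = 3 ^ 6.\<close>
  then have "\<exists>D. rpdt n (26 / 100) P D (s ^ 3)"
    by (rule step) (auto simp: power2_eq_square power3_eq_cube)
  then have "\<exists>D. rpdt n (17 / 100) P D ((s ^ 3) ^ 3)"
    by (rule step) (auto simp: power2_eq_square power3_eq_cube)
  then have "\<exists>D. rpdt n (8 / 100) P D (((s ^ 3) ^ 3) ^ 3)"
    by (rule step) (auto simp: power2_eq_square power3_eq_cube)
  then have "\<exists>D. rpdt n (2 / 100) P D ((((s ^ 3) ^ 3) ^ 3) ^ 3)"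
    by (rule step) (auto simp: power2_eq_square power3_eq_cube)
  then have "\<exists>D. rpdt n (2 / 1000) P D (((((s ^ 3) ^ 3) ^ 3) ^ 3) ^ 3)"
    by (rule step) (auto simp: power2_eq_square power3_eq_cube)
  then have "\<exists>D. rpdt n (1 / 2 ^ 16) P D ((((((s ^ 3) ^ 3) ^ 3) ^ 3) ^ 3) ^ 3)"
    by (rule step) (auto simp: power2_eq_square power3_eq_cube)
  then show ?thesis by (simp flip: power_mult)
qed

section \<open>Existence of trees and trivial size bounds\<close>

lemma ip2_unit:
  assumes "length x = n" "m < n"
  shows "ip2 x ((replicate n False)[m := True]) \<longleftrightarrow> x ! m"
proof -
  have "{i. i < length x \<and> i < length ((replicate n False)[m := True]) \<and> x ! i \<and> (replicate n False)[m := True] ! i}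
      = (if x ! m then {m} else {})"
    using assms by (auto simp: nth_list_update split: if_splits)
  then show ?thesis by (simp add: ip2_def)
qed

text \<open>The root reads the last coordinate of the prefix through a unit vector. Overwriting that
  coordinate by the answer leaves a predicate that depends on a shorter prefix.\<close>

lemma ex_pdt_prefix:
  assumes "m \<le> n"
    and "\<And>x y. length x = n \<Longrightarrow> length y = n \<Longrightarrow> (\<And>i. i < m \<Longrightarrow> x ! i = y ! i) \<Longrightarrow> P x = P y"
  shows "\<exists>T. pdt_wf n T \<and> (\<forall>x. length x = n \<longrightarrow> pdt_eval T x = P x)"
  using assms
proof (induction m arbitrary: P)
  case 0
  have "pdt_eval (Leaf (P (replicate n False))) x = P x" if "length x = n" for x
    using 0(2)[of "replicate n False" x] that by simp
  then show ?case using pdt_wf.simps(1) by blast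
next
  case (Suc m)
  have "\<exists>T. pdt_wf n T \<and> (\<forall>x. length x = n \<longrightarrow> pdt_eval T x = P (x[m := v]))" for v
  proof (rule Suc.IH)
    fix x y :: "bool list"
    assume *: "length x = n" "length y = n" "\<And>i. i < m \<Longrightarrow> x ! i = y ! i"
    show "P (x[m := v]) = P (y[m := v])"
      by (rule Suc.prems(2)) (use * Suc.prems(1) in \<open>auto simp: nth_list_update less_Suc_eq\<close>)
  qed (use Suc.prems in auto)
  then obtain T where T: "pdt_wf n (T v)" "length x = n \<Longrightarrow> pdt_eval (T v) x = P (x[m := v])" for v x
    by metis
  have "pdt_eval (Node ((replicate n False)[m := True]) (T False) (T True)) x = P x" if "length x = n" for x
    using T(2)[OF that] ip2_unit[OF that, of m] Suc.prems(1) list_update_id[of x m] by (cases "x ! m") auto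
  moreover have "pdt_wf n (Node ((replicate n False)[m := True]) (T False) (T True))"
    using T(1) by simp
  ultimately show ?case by blast
qed

text \<open>An exact deterministic tree exists for every predicate, so the \<open>LEAST\<close> in
  \<open>PS\<close> ranges over a nonempty set and is attained.\<close>

lemma rpdt_PS:
  assumes "0 \<le> \<delta>"
  shows "\<exists>D. rpdt n \<delta> P D (PS n \<delta> P)"
proof -
  obtain T where T: "pdt_wf n T" "\<And>x. length x = n \<Longrightarrow> pdt_eval T x = P x"
  proof -
    have "\<exists>T. pdt_wf n T \<and> (\<forall>x. length x = n \<longrightarrow> pdt_eval T x = P x)"
      by (rule ex_pdt_prefix[of n]) (auto intro!: arg_cong[where f = P] nth_equalityI)
    then show ?thesis using that by blast
  qed
  have "rpdt n \<delta> P (return_pmf T) (pdt_size T)"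
    using T assms by (auto simp: rpdt_def indicator_def)
  then have "\<exists>s D. rpdt n \<delta> P D s" by blast
  then show ?thesis
    unfolding PS_def by (rule LeastI_ex)
qed

text \<open>Smaller trees are single leaves and accept \<open>x\<close> and \<open>y\<close> equally
  often, which an error below 1/2 forbids.\<close>

lemma rpdt_size_ge_2:
  assumes D: "rpdt n \<delta> P D s" and "\<delta> < 1 / 2"
    and xy: "length x = n" "length y = n" "P x" "\<not> P y"
  shows "2 \<le> s"
proof (rule ccontr)
  assume "\<not> 2 \<le> s"
  have "pdt_eval T x = pdt_eval T y" if T: "T \<in> set_pmf D" for T
  proof -
    have "pdt_size T < 2" using D T \<open>\<not> 2 \<le> s\<close> by (force simp: rpdt_def)
    then show ?thesis
    proof (cases T)
      case (Node q l r)
      then show ?thesis using \<open>pdt_size T < 2\<close> pdt_size_pos[of l] pdt_size_pos[of r] by simp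
    qed simp
  qed
  then have "measure_pmf.prob D {T. pdt_eval T x} = measure_pmf.prob D {T. pdt_eval T y}"
    by (intro measure_pmf.finite_measure_eq_AE) (auto simp: AE_measure_pmf_iff)
  then show False
    using rpdt_accept_bounds[OF D, of x] rpdt_accept_bounds[OF D, of y] xy assms(2) by simp
qed

lemma hw_rpdt_size_ge_2:
  assumes "rpdt n \<delta> (hw_pred n k) D s" "\<delta> < 1 / 2" "1 \<le> k" "k \<le> n"
  shows "2 \<le> s"
proof (rule rpdt_size_ge_2[OF assms(1,2)])
  show "hw_pred n k (replicate k True @ replicate (n - k) False)" "\<not> hw_pred n k (replicate n False)"
    using assms by (auto simp: hw_pred_def count_list_eq_length_filter)
qed (use assms in auto)

section \<open>Combining the ranges of error and weight\<close>

lemma weight_le_length: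
  fixes k n :: nat and \<delta> :: real
  assumes "real k ^ 2 < \<delta> * n" "\<delta> \<le> 1"
  shows "k \<le> n"
proof -
  have "\<delta> * n \<le> 1 * real n" using assms(2) by (intro mult_right_mono) auto
  moreover have "real k \<le> real k ^ 2" by (cases k) (auto simp: power2_eq_square)
  ultimately have "real k \<le> real n" using assms(1) by linarith
  then show ?thesis by simp
qed

text \<open>The choice t = k starts the walk at the zero vector; its collision bound is of order k^2
  / n, which is below the order of \<delta>.\<close>

lemma rpdt_bound_small_error:
  assumes "1 \<le> k" "0 < \<delta>" "\<delta> \<le> 1 / 2 ^ 16" "real k ^ 2 < \<delta> * n" "rpdt n \<delta> (hw_pred n k) D s"
  shows "k / 4 * log 2 (k / \<delta>) \<le> log 2 s"
proof (rule rpdt_size_bound[OF assms(5)])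
  have "real (k + 2) * real (k + 1) \<le> real (3 * k) * real (2 * k)"
    using assms(1) by (intro mult_mono) auto
  then show "real (k + 2) * real (k - k) + real (k + 2) * real (k + 1) / 2 \<le> 3 * \<delta> * n"
    using assms(4) by (simp add: power2_eq_square)
  show "k \<le> n" using assms by (intro weight_le_length[of k \<delta>]) auto
qed (use assms in auto)

text \<open>After amplification the error is 1 / 2 ^ 16, but only 3 * k^2 \<le> n is available, so
  the collision bound for k steps may be too large. About k / 2 ^ 16 steps from weight k - t bring
  it down by the same factor.\<close>

lemma rpdt_bound_large_k:
  assumes k: "65536 \<le> k" and \<delta>: "1 / 2 ^ 16 \<le> \<delta>" "\<delta> \<le> 1 / 3"
    and n: "real k ^ 2 < \<delta> * n" and D: "rpdt n \<delta> (hw_pred n k) D s"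
  shows "k / 2 ^ 31 * log 2 (k / \<delta>) \<le> log 2 s"
proof -
  obtain D' where D': "rpdt n (1 / 2 ^ 16) (hw_pred n k) D' (s ^ 729)"
    using rpdt_amplify[OF D \<delta>(2)] by blast
  define t where "t = k div 65536"
  have t: "1 \<le> t" "t \<le> k" "65536 * t \<le> k" "k < 65536 * t + 65536"
    using k div_mult_mod_eq[of k 65536] mod_less_divisor[of 65536 k]
    by (auto simp: t_def div_greater_zero_iff Suc_le_eq)
  have tk: "real k \<le> 131072 * real t" "65536 * real t \<le> real k" using t by linarith+
  have n3: "3 * real k ^ 2 \<le> n"
    using n \<delta>(2) mult_right_mono[of \<delta> "1/3" "real n"] by simp
  have "k \<le> n" using n \<delta> by (intro weight_le_length[of k \<delta>]) auto
  have "t / 4 * log 2 (t / (1 / 2 ^ 16)) \<le> log 2 (s ^ 729)"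
  proof (rule rpdt_size_bound[OF D' t(1,2) \<open>k \<le> n\<close>])
    have "real (t + 2) * real (k - t) + real (t + 2) * real (t + 1) / 2 = real (t + 2) * (real (k - t) + (real t + 1) / 2)"
      by (simp add: algebra_simps)
    also have "\<dots> \<le> (3 * real t) * k"
      using t by (intro mult_mono) (auto simp: of_nat_diff)
    also have "\<dots> \<le> 3 * (real k / 65536) * k"
      using tk by (intro mult_right_mono) auto
    also have "\<dots> \<le> 3 * (1 / 2 ^ 16) * n"
      using n3 by (simp add: power2_eq_square)
    finally show "real (t + 2) * real (k - t) + real (t + 2) * real (t + 1) / 2 \<le> 3 * (1 / 2 ^ 16) * n" .
  qed auto
  then have main: "t / 4 * log 2 (65536 * real t) \<le> log 2 (s ^ 729)"
    by (simp add: mult.commute)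
  have "2 \<le> s" using hw_rpdt_size_ge_2[OF D] \<delta> k \<open>k \<le> n\<close> by simp
  then have ls: "log 2 (real (s ^ 729)) = 729 * log 2 s"
    by (simp add: log_nat_power)
  \<comment> \<open>The logarithm in the claim is compared with the one obtained for t: k / \<delta>
    \<le> 2^33 * t \<le> (2^16 * t)^3.\<close>
  have "log 2 (k / \<delta>) \<le> log 2 ((65536 * real t) ^ 3)"
  proof (subst log_le_cancel_iff)
    have "k / \<delta> \<le> k / (1 / 2 ^ 16)"
      using \<delta>(1) by (intro divide_left_mono) auto
    also have "\<dots> \<le> (131072 * real t) * 65536"
      using tk by simp
    also have "\<dots> \<le> (65536 * real t) * (65536 * real t) * (65536 * real t)"
    proof -
      have "1 \<le> real t * real t" using t(1) mult_mono[of 1 "real t" 1 "real t"] by simp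
      then have "real t * 1 \<le> real t * (real t * real t)" by (intro mult_left_mono) auto
      then show ?thesis by simp
    qed
    finally show "k / \<delta> \<le> (65536 * real t) ^ 3" by (simp add: power3_eq_cube mult_ac)
  qed (use k t \<delta> in \<open>auto intro!: divide_pos_pos zero_less_power\<close>)
  also have "\<dots> = 3 * log 2 (65536 * real t)"
    using t(1) by (subst log_nat_power) auto
  finally have l: "log 2 (k / \<delta>) \<le> 3 * log 2 (65536 * real t)" .
  have pos: "0 \<le> log 2 (65536 * real t)"
    using t(1) by (subst zero_le_log_cancel_iff) auto
  have "k / 2 ^ 31 * log 2 (k / \<delta>) \<le> k / 2 ^ 31 * (3 * log 2 (65536 * real t))"
    using l by (intro mult_left_mono) auto
  also have "\<dots> = real k * (3 / 2 ^ 31) * log 2 (65536 * real t)"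
    by simp
  also have "\<dots> \<le> (131072 * real t) * (3 / 2 ^ 31) * log 2 (65536 * real t)"
    using tk pos by (intro mult_right_mono) auto
  also have "\<dots> = (131072 * 12 / 2 ^ 31) * (t / 4 * log 2 (65536 * real t))"
    by simp
  also have "\<dots> \<le> (131072 * 12 / 2 ^ 31) * (729 * log 2 s)"
    using main ls by (intro mult_left_mono) auto
  \<comment> \<open>The constant 2 ^ 31 is large enough because 131072 * 12 * 729 = 2^17 * 8748 is
    below it.\<close>
  also have "\<dots> \<le> log 2 s"
    using \<open>2 \<le> s\<close> by simp
  finally show ?thesis .
qed

theorem theorem1p9:
  shows "\<exists>c>0. \<forall>(n::nat) (k::nat) (\<delta>::real).
           1 \<le> k \<and> 0 < \<delta> \<and> \<delta> \<le> 1/3 \<and> real k ^ 2 < \<delta> * real n \<longrightarrow>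
           log 2 (real (PS n \<delta> (hw_pred n k))) \<ge> c * real k * log 2 (real k / \<delta>)"
proof (intro exI[of _ "1 / 2 ^ 31"] conjI allI impI)
  fix n k :: nat and \<delta> :: real
  assume *: "1 \<le> k \<and> 0 < \<delta> \<and> \<delta> \<le> 1/3 \<and> real k ^ 2 < \<delta> * real n"
  let ?s = "PS n \<delta> (hw_pred n k)"
  obtain D where D: "rpdt n \<delta> (hw_pred n k) D ?s"
    using rpdt_PS[of \<delta>] * by auto
  have k\<delta>: "0 \<le> log 2 (k / \<delta>)"
    using * by (subst zero_le_log_cancel_iff) (auto simp: le_divide_eq)
  \<comment> \<open>Small error is handled directly and large weight by amplification. In the
    remaining range k / \<delta> is at most 2^32, so the claimed bound is at most 1 and follows from
    size at least 2.\<close>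
  consider "\<delta> \<le> 1 / 2 ^ 16" | "1 / 2 ^ 16 < \<delta>" "65536 \<le> k" | "1 / 2 ^ 16 < \<delta>" "k < 65536"
    by linarith
  then show "1 / 2 ^ 31 * real k * log 2 (real k / \<delta>) \<le> log 2 (real ?s)"
  proof cases
    case 1
    have "1 / 2 ^ 31 * real k * log 2 (k / \<delta>) \<le> k / 4 * log 2 (k / \<delta>)"
      using k\<delta> by (intro mult_right_mono) auto
    also have "\<dots> \<le> log 2 ?s"
      using rpdt_bound_small_error[OF _ _ 1 _ D] * by simp
    finally show ?thesis .
  next
    case 2
    then show ?thesis
      using rpdt_bound_large_k[OF 2(2) _ _ _ D] * by simp
  next
    case 3
    have "k / \<delta> \<le> k / (1 / 2 ^ 16)"
      using 3 by (intro divide_left_mono) auto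
    also have "\<dots> \<le> 2 ^ 32" using 3 by simp
    finally have "log 2 (k / \<delta>) \<le> log 2 (2 ^ 32)"
      using * by (subst log_le_cancel_iff) auto
    also have "\<dots> = 32" by (subst log_nat_power) auto
    finally have "1 / 2 ^ 31 * real k * log 2 (k / \<delta>) \<le> 1 / 2 ^ 31 * 65536 * 32"
      using 3 k\<delta> by (intro mult_mono) auto
    also have "\<dots> \<le> 1" by simp
    also have "1 \<le> log 2 ?s"
    proof -
      have "k \<le> n" using * by (intro weight_le_length[of k \<delta>]) auto
      then have "2 \<le> ?s" using hw_rpdt_size_ge_2[OF D] * by simp
      then show ?thesis by (subst le_log_iff) auto
    qed
    finally show ?thesis .
  qed
qed simp

end
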